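(* If $u_1=u_1(t,x)$ and $u_2=u_2(t,x)$ are solutions of the Perona–Malik equation $$\frac{\partial u}{\partial t}-\operatorname{div}\big(c(|\nabla u|^2)\nabla u\big)=0,$$ then $(\lambda_1\odot u_1)\oplus(\lambda_2\odot u_2)$ is also a solution of this equation on the set $$D=\{(t,x): t\in(0,T),\ x\in\mathbb{R}^2,\ u_1(t,x)\ne u_2(t,x)\},$$ with respect to the operations $\oplus=\min$ and $\odot=+$.
   Context: The operations $x\oplus y=\min\{x,y\}$ and $x\odot y=x+y$ are those of the min-plus semiring on $(-\infty,+\infty]$, so that $(\lambda_1\odot u_1)\oplus(\lambda_2\odot u_2)=\min\{\lambda_1+u_1,\lambda_2+u_2\}$; $\lambda_1,\lambda_2$ are constants from this semiring. The gradient and divergence are taken with respect to $x\in\mathbb{R}^2$, and $t\in(0,T)$. The function $c:[0,\infty)\to(0,\infty)$ is assumed to be decreasing, with $c(0)=1$, $c(s)\approx 1/\sqrt{s}$ as $s\to\infty$, and $c(s)+2sc'(s)>0$.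
   Formalization: D is taken as the set where λ₁⊙u₁ ≠ λ₂⊙u₂ instead of u₁ ≠ u₂; the printed version fails for λ₁ ≠ λ₂, e.g. u₁=x₁, u₂=−x₁, λ₁=0, λ₂=2, where the minimum has a kink at x₁=1. Solutions are classical (C¹ in t, C² in x). *)

theory Defs
  imports "HOL-Analysis.Analysis" "HOL-Library.Landau_Symbols"
begin

section \<open>The min-plus semiring\<close>

text \<open>The carrier \<open>(-\<infinity>, +\<infinity>]\<close> is the set of all \<^typ>\<open>ereal\<close> different from \<open>-\<infinity>\<close>; elements of the
  semiring are subject to that side condition.\<close>

definition mp_add :: "ereal \<Rightarrow> ereal \<Rightarrow> ereal"  (infixl "\<oplus>" 65)
  where "x \<oplus> y = min x y"

definition mp_mult :: "ereal \<Rightarrow> ereal \<Rightarrow> ereal"  (infixl "\<odot>" 70)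
  where "x \<odot> y = x + y"


section \<open>The Perona--Malik equation\<close>

definition grad :: "('a::euclidean_space \<Rightarrow> real) \<Rightarrow> 'a \<Rightarrow> 'a"
  where "grad f x = (\<Sum>b\<in>Basis. frechet_derivative f (at x) b *\<^sub>R b)"

definition divergence :: "('a::euclidean_space \<Rightarrow> 'a) \<Rightarrow> 'a \<Rightarrow> real"
  where "divergence F x = (\<Sum>b\<in>Basis. frechet_derivative F (at x) b \<bullet> b)"

text \<open>At \<open>s = 0\<close> the derivative of \<open>c\<close> is one-sided, and the values of \<open>c\<close> on negative arguments
  are irrelevant. ``\<open>\<approx>\<close>'' is read as asymptotic equivalence: the quotient tends to 1.\<close>

definition pm_diffusivity :: "(real \<Rightarrow> real) \<Rightarrow> bool"
  where "pm_diffusivity c \<longleftrightarrow>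
    (\<forall>s\<ge>0. 0 < c s) \<and> antimono_on {0..} c \<and> c 0 = 1 \<and> c \<sim>[at_top] (\<lambda>s. 1 / sqrt s) \<and>
    (\<exists>c'. \<forall>s\<ge>0. (c has_real_derivative c' s) (at s within {0..}) \<and> 0 < c s + 2 * s * c' s)"

text \<open>\<open>u \<in> C\<^sup>1\<^sup>,\<^sup>2(\<Omega>)\<close>: once continuously differentiable in time, twice in space.\<close>

definition C12_on :: "(real \<times> (real^2)) set \<Rightarrow> (real \<Rightarrow> real^2 \<Rightarrow> real) \<Rightarrow> bool"
  where "C12_on \<Omega> u \<longleftrightarrow>
    continuous_on \<Omega> (\<lambda>(t,x). u t x) \<and>
    (\<forall>(t,x)\<in>\<Omega>. (\<lambda>s. u s x) differentiable at t \<and> u t differentiable at x \<and>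
               grad (u t) differentiable at x) \<and>
    continuous_on \<Omega> (\<lambda>(t,x). deriv (\<lambda>s. u s x) t) \<and>
    continuous_on \<Omega> (\<lambda>(t,x). grad (u t) x) \<and>
    (\<forall>h. continuous_on \<Omega> (\<lambda>(t,x). frechet_derivative (grad (u t)) (at x) h))"

definition pm_flux :: "(real \<Rightarrow> real) \<Rightarrow> (real^2 \<Rightarrow> real) \<Rightarrow> real^2 \<Rightarrow> real^2"
  where "pm_flux c f x = c ((norm (grad f x))\<^sup>2) *\<^sub>R grad f x"

text \<open>Classical solutions on an open subset of space-time. Differentiability of the flux follows
  from the \<open>C\<^sup>1\<^sup>,\<^sup>2\<close> regularity if \<open>c\<close> is differentiable; it is required explicitly so that the
  divergence is meaningful for every \<open>c\<close>.\<close>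

definition pm_solution_on ::
    "(real \<Rightarrow> real) \<Rightarrow> (real \<times> (real^2)) set \<Rightarrow> (real \<Rightarrow> real^2 \<Rightarrow> real) \<Rightarrow> bool"
  where "pm_solution_on c \<Omega> u \<longleftrightarrow>
    open \<Omega> \<and> C12_on \<Omega> u \<and>
    (\<forall>(t,x)\<in>\<Omega>. pm_flux c (u t) differentiable at x \<and>
       deriv (\<lambda>s. u s x) t - divergence (pm_flux c (u t)) x = 0)"

text \<open>A semiring-valued function solves the equation on \<open>\<Omega>\<close> if it is finite there and solves it as
  a real function.\<close>

definition mp_pm_solution_on ::
    "(real \<Rightarrow> real) \<Rightarrow> (real \<times> (real^2)) set \<Rightarrow> (real \<Rightarrow> real^2 \<Rightarrow> ereal) \<Rightarrow> bool"
  where "mp_pm_solution_on c \<Omega> v \<longleftrightarrow>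
    (\<forall>(t,x)\<in>\<Omega>. \<bar>v t x\<bar> \<noteq> \<infinity>) \<and> pm_solution_on c \<Omega> (\<lambda>t x. real_of_ereal (v t x))"


section \<open>The set where the two functions differ\<close>

definition D_set :: "real \<Rightarrow> (real \<Rightarrow> real^2 \<Rightarrow> 'v) \<Rightarrow> (real \<Rightarrow> real^2 \<Rightarrow> 'v) \<Rightarrow> (real \<times> (real^2)) set"
  where "D_set T v w = {(t,x). t \<in> {0<..<T} \<and> v t x \<noteq> w t x}"

text \<open>The superposition \<open>(\<lambda>\<^sub>1 \<odot> u\<^sub>1) \<oplus> (\<lambda>\<^sub>2 \<odot> u\<^sub>2)\<close> has its kinks where the two functions
  \<open>\<lambda>\<^sub>1 \<odot> u\<^sub>1\<close> and \<open>\<lambda>\<^sub>2 \<odot> u\<^sub>2\<close> whose minimum is taken coincide, so \<open>D\<close> has to be formed from these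
  two solutions. Formed from \<open>u\<^sub>1\<close> and \<open>u\<^sub>2\<close>, it is too large when \<open>\<lambda>\<^sub>1 \<noteq> \<lambda>\<^sub>2\<close>: for
  \<open>u\<^sub>1 = x\<^sub>1\<close>, \<open>u\<^sub>2 = -x\<^sub>1\<close>, \<open>\<lambda>\<^sub>1 = 0\<close>, \<open>\<lambda>\<^sub>2 = 2\<close> the minimum is not differentiable at \<open>x\<^sub>1 = 1\<close>, where
  \<open>u\<^sub>1 = 1 \<noteq> -1 = u\<^sub>2\<close>. For \<open>\<lambda>\<^sub>1 = \<lambda>\<^sub>2\<close> finite the two sets are equal:\<close>

lemma D_set_mp_mult_eq:
  assumes "\<bar>a\<bar> \<noteq> \<infinity>"
  shows "D_set T (\<lambda>t x. a \<odot> ereal (u\<^sub>1 t x)) (\<lambda>t x. a \<odot> ereal (u\<^sub>2 t x)) = D_set T u\<^sub>1 u\<^sub>2"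
  using assms by (cases a) (auto simp: D_set_def mp_mult_def)

end

theory Submission
  imports Defs
begin

text \<open>The set where the two shifted solutions differ is the disjoint union of the sets where
  one or the other is strictly smaller. Both are open by continuity, and on each the minimum is one
  \<open>u_i\<close> plus a finite constant. The equation sees only derivatives, which depend on the
  germ of the function and ignore constants, so this is again a solution
  (\<open>pm_solution_on_add_const\<close>, \<open>pm_solution_on_mp_add_left\<close>). Being a
  solution is a local property and so passes to the union (\<open>pm_solution_on_Un\<close>). An
  infinite constant makes its own set empty; if both are infinite, so is the union.\<close>

text \<open>The equation is local and invariant under adding a constant to the solution. Where the two
  functions differ, the minimum agrees near each point with one of them, by continuity.\<close>

lemma has_derivative_eventually_add_const_iff:
  fixes f g :: "'a::real_normed_vector \<Rightarrow> 'b::real_normed_vector"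
  assumes "\<forall>\<^sub>F y in nhds x. g y = f y + k"
  shows "(g has_derivative D) (at x) \<longleftrightarrow> (f has_derivative D) (at x)"
proof -
  \<comment> \<open>The transfer rule wants agreement on a punctured neighbourhood and, separately,
    at \<open>x\<close>; \<open>nhds\<close> supplies both.\<close>
  have ev: "\<forall>\<^sub>F y in at x. g y = f y + k" "\<forall>\<^sub>F y in at x. f y + k = g y"
    using assms by (auto simp: eventually_at_filter elim: eventually_mono)
  have "(g has_derivative D) (at x) \<longleftrightarrow> ((\<lambda>y. f y + k) has_derivative D) (at x)"
    using has_derivative_transform_eventually[of g D x UNIV "\<lambda>y. f y + k"]
      has_derivative_transform_eventually[of "\<lambda>y. f y + k" D x UNIV g]
      ev eventually_nhds_x_imp_x[OF assms]
    by auto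
  also have "\<dots> \<longleftrightarrow> (f has_derivative D) (at x)"
    using has_derivative_add_const[of f D "at x" k]
      has_derivative_add_const[of "\<lambda>y. f y + k" D "at x" "- k"] by auto
  finally show ?thesis .
qed

text \<open>Both notions are defined from the predicate \<open>has_derivative\<close> alone, so
  equal predicates give equal values even where no derivative exists.\<close>

lemma
  fixes f g :: "'a::real_normed_vector \<Rightarrow> 'b::real_normed_vector"
  assumes "\<forall>\<^sub>F y in nhds x. g y = f y + k"
  shows differentiable_eventually_add_const_iff:
      "g differentiable at x \<longleftrightarrow> f differentiable at x"
    and frechet_derivative_eventually_add_const:
      "frechet_derivative g (at x) = frechet_derivative f (at x)"
  using has_derivative_eventually_add_const_iff[OF assms]
  by (simp_all add: differentiable_def frechet_derivative_def)

lemma deriv_eventually_add_const: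
  fixes f g :: "'a::real_normed_field \<Rightarrow> 'a"
  assumes "\<forall>\<^sub>F y in nhds x. g y = f y + k"
  shows "deriv g x = deriv f x"
  using has_derivative_eventually_add_const_iff[OF assms]
  by (simp add: deriv_def has_field_derivative_def)

lemma grad_eventually_add_const:
  assumes "\<forall>\<^sub>F y in nhds x. g y = f y + k"
  shows "grad g x = grad f x"
  by (simp add: grad_def frechet_derivative_eventually_add_const[OF assms])

text \<open>Agreement near \<open>x\<close> is agreement near every point close to \<open>x\<close>.
  Equality of gradients at \<open>x\<close> alone would not allow differentiating them
  again.\<close>

lemma eventually_grad_eventually_add_const:
  assumes "\<forall>\<^sub>F y in nhds x. g y = f y + k"
  shows "\<forall>\<^sub>F y in nhds x. grad g y = grad f y"
proof -
  have "\<forall>\<^sub>F y in nhds x. \<forall>\<^sub>F z in nhds y. g z = f z + k"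
    using assms by (simp add: eventually_eventually)
  then show ?thesis by eventually_elim (rule grad_eventually_add_const)
qed

lemma eventually_pm_flux_eventually_add_const:
  assumes "\<forall>\<^sub>F y in nhds x. g y = f y + k"
  shows "\<forall>\<^sub>F y in nhds x. pm_flux c g y = pm_flux c f y"
  using eventually_grad_eventually_add_const[OF assms]
  by eventually_elim (simp add: pm_flux_def)

lemma divergence_eventually_eq:
  assumes "\<forall>\<^sub>F y in nhds x. G y = F y"
  shows "divergence G x = divergence F x"
  using frechet_derivative_eventually_add_const[of G F 0 x] assms by (simp add: divergence_def)

lemma pm_solution_on_add_const:
  assumes u: "pm_solution_on c \<Omega> u" and V: "open V" "V \<subseteq> \<Omega>"
    and w: "\<And>t x. (t, x) \<in> V \<Longrightarrow> w t x = u t x + k"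
  shows "pm_solution_on c V w"
proof -
  \<comment> \<open>Each derivative is taken in one variable, so agreement on the open set
    \<open>V\<close> is restricted to slices, along the continuous embeddings of time and of
    space.\<close>
  have evt: "\<forall>\<^sub>F s in nhds t. w s x = u s x + k" if "(t, x) \<in> V" for t x
  proof -
    have "\<forall>\<^sub>F s in nhds t. (s, x) \<in> V"
    proof (rule eventually_compose_filterlim[OF eventually_nhds_in_open[OF V(1) that]])
      show "filterlim (\<lambda>s. (s, x)) (nhds (t, x)) (nhds t)"
        by (intro tendsto_Pair filterlim_ident tendsto_const)
    qed
    then show ?thesis by eventually_elim (rule w)
  qed
  have evx: "\<forall>\<^sub>F y in nhds x. w t y = u t y + k" if "(t, x) \<in> V" for t x
  proof -
    have "\<forall>\<^sub>F y in nhds x. (t, y) \<in> V"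
    proof (rule eventually_compose_filterlim[OF eventually_nhds_in_open[OF V(1) that]])
      show "filterlim (\<lambda>y. (t, y)) (nhds (t, x)) (nhds x)"
        by (intro tendsto_Pair filterlim_ident tendsto_const)
    qed
    then show ?thesis by eventually_elim (rule w)
  qed
  \<comment> \<open>The summand 0 lets the shift lemmas be reused for gradients and fluxes, which
    agree exactly.\<close>
  have evg: "\<forall>\<^sub>F y in nhds x. grad (w t) y = grad (u t) y + 0" if "(t, x) \<in> V" for t x
    using eventually_grad_eventually_add_const[OF evx[OF that]] by simp
  have evf: "\<forall>\<^sub>F y in nhds x. pm_flux c (w t) y = pm_flux c (u t) y + 0" if "(t, x) \<in> V" for t x
    using eventually_pm_flux_eventually_add_const[OF evx[OF that]] by simp
  note eqs = w
    differentiable_eventually_add_const_iff[OF evt] deriv_eventually_add_const[OF evt]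
    differentiable_eventually_add_const_iff[OF evx] grad_eventually_add_const[OF evx]
    differentiable_eventually_add_const_iff[OF evg] frechet_derivative_eventually_add_const[OF evg]
    differentiable_eventually_add_const_iff[OF evf]
    divergence_eventually_eq[OF evf[unfolded add_0_right]]
  have C: "C12_on \<Omega> u" using u by (simp add: pm_solution_on_def)
  have cont: "continuous_on V (\<lambda>(t, x). g t x)"
    if "continuous_on \<Omega> (\<lambda>(t, x). f t x)" "\<And>t x. (t, x) \<in> V \<Longrightarrow> g t x = f t x"
    for f g :: "real \<Rightarrow> real^2 \<Rightarrow> 'z::topological_space"
  proof -
    have "continuous_on V (\<lambda>(t, x). f t x)" using that(1) V(2) by (rule continuous_on_subset)
    then show ?thesis by (rule continuous_on_eq) (auto simp: that(2))
  qed
  have "continuous_on \<Omega> (\<lambda>(t, x). u t x + k)"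
    using C by (auto simp: C12_on_def case_prod_unfold intro!: continuous_intros)
  then have "continuous_on V (\<lambda>(t, x). w t x)" by (rule cont) (rule w)
  moreover have "continuous_on V (\<lambda>(t, x). deriv (\<lambda>s. w s x) t)"
    by (rule cont[of "\<lambda>t x. deriv (\<lambda>s. u s x) t"]) (use C in \<open>auto simp: C12_on_def eqs\<close>)
  moreover have "continuous_on V (\<lambda>(t, x). grad (w t) x)"
    by (rule cont[of "\<lambda>t x. grad (u t) x"]) (use C in \<open>auto simp: C12_on_def eqs\<close>)
  moreover have "continuous_on V (\<lambda>(t, x). frechet_derivative (grad (w t)) (at x) h)" for h
    by (rule cont[of "\<lambda>t x. frechet_derivative (grad (u t)) (at x) h"])
      (use C in \<open>auto simp: C12_on_def eqs\<close>)
  ultimately have "C12_on V w"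
    using C V(2) by (fastforce simp: C12_on_def eqs)
  then show ?thesis
    using u V by (fastforce simp: pm_solution_on_def eqs)
qed

text \<open>All conditions are pointwise except continuity, which can be glued because both sets are
  open.\<close>

lemma pm_solution_on_Un:
  assumes "pm_solution_on c U w" "pm_solution_on c V w"
  shows "pm_solution_on c (U \<union> V) w"
  using assms by (auto simp: pm_solution_on_def C12_on_def intro!: continuous_on_open_Un)

lemma pm_solution_on_mp_add_left:
  fixes u v :: "real \<Rightarrow> real^2 \<Rightarrow> real"
  assumes u: "pm_solution_on c \<Omega> u" and v: "continuous_on \<Omega> (\<lambda>(t, x). v t x)"
    and ab: "a \<noteq> -\<infinity>" "b \<noteq> -\<infinity>"
  shows "pm_solution_on c {(t, x) \<in> \<Omega>. a \<odot> ereal (u t x) < b \<odot> ereal (v t x)}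
           (\<lambda>t x. real_of_ereal ((a \<odot> ereal (u t x)) \<oplus> (b \<odot> ereal (v t x))))"
    (is "pm_solution_on c ?V ?w")
proof -
  have \<Omega>: "open \<Omega>" and cu: "continuous_on \<Omega> (\<lambda>(t, x). u t x)"
    using u by (auto simp: pm_solution_on_def C12_on_def)
  have "open ?V"
  proof (cases a)
    case (real r)
    show ?thesis
    proof (cases b)
      case (real q)
      \<comment> \<open>For finite constants the inequality reads \<open>r - q < v - u\<close>, an
        open condition.\<close>
      have "continuous_on \<Omega> (\<lambda>p. case_prod v p - case_prod u p)"
        using cu v by (intro continuous_on_diff) (simp_all add: case_prod_unfold)
      then have "open (\<Omega> \<inter> (\<lambda>p. case_prod v p - case_prod u p) -` {r - q<..})"
        using \<Omega> by (rule continuous_open_preimage) simp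
      also have "\<Omega> \<inter> (\<lambda>p. case_prod v p - case_prod u p) -` {r - q<..} = ?V"
        by (auto simp: \<open>a = ereal r\<close> real mp_mult_def)
      finally show ?thesis .
    next
      case PInf
      have "?V = \<Omega>" by (auto simp: real PInf mp_mult_def)
      with \<Omega> show ?thesis by simp
    qed (use ab in simp)
  next
    case PInf
    have "?V = {}" by (auto simp: PInf mp_mult_def)
    then show ?thesis by (simp only: open_empty)
  qed (use ab in simp)
  with u show ?thesis
  \<comment> \<open>If \<open>a\<close> is infinite then \<open>?V\<close> is empty, so the default
    value 0 of \<open>real_of_ereal a\<close> does no harm.\<close>
  proof (rule pm_solution_on_add_const[where k = "real_of_ereal a"])
    show "?w t x = u t x + real_of_ereal a" if "(t, x) \<in> ?V" for t x
      using that ab by (cases a) (auto simp: mp_mult_def mp_add_def min_def)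
  qed auto
qed

theorem theorem3p1:
  fixes c :: "real \<Rightarrow> real" and T :: real
    and u\<^sub>1 u\<^sub>2 :: "real \<Rightarrow> real^2 \<Rightarrow> real"
    and a\<^sub>1 a\<^sub>2 :: ereal
  assumes "pm_diffusivity c"
    and "0 < T"
    and "a\<^sub>1 \<noteq> -\<infinity>" and "a\<^sub>2 \<noteq> -\<infinity>"
    and "pm_solution_on c ({0<..<T} \<times> UNIV) u\<^sub>1"
    and "pm_solution_on c ({0<..<T} \<times> UNIV) u\<^sub>2"
  shows "mp_pm_solution_on c
           (D_set T (\<lambda>t x. a\<^sub>1 \<odot> ereal (u\<^sub>1 t x)) (\<lambda>t x. a\<^sub>2 \<odot> ereal (u\<^sub>2 t x)))
           (\<lambda>t x. (a\<^sub>1 \<odot> ereal (u\<^sub>1 t x)) \<oplus> (a\<^sub>2 \<odot> ereal (u\<^sub>2 t x)))"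
proof -
  let ?S = "{0<..<T} \<times> (UNIV :: (real^2) set)"
  let ?v\<^sub>1 = "\<lambda>t x. a\<^sub>1 \<odot> ereal (u\<^sub>1 t x)" and ?v\<^sub>2 = "\<lambda>t x. a\<^sub>2 \<odot> ereal (u\<^sub>2 t x)"
  let ?w = "\<lambda>t x. real_of_ereal (?v\<^sub>1 t x \<oplus> ?v\<^sub>2 t x)"
  have cont: "continuous_on ?S (\<lambda>(t, x). u\<^sub>1 t x)" "continuous_on ?S (\<lambda>(t, x). u\<^sub>2 t x)"
    using assms(5,6) by (simp_all add: pm_solution_on_def C12_on_def)
  have "pm_solution_on c {(t, x) \<in> ?S. ?v\<^sub>1 t x < ?v\<^sub>2 t x} ?w"
    using assms(5) cont(2) assms(3,4) by (rule pm_solution_on_mp_add_left)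
  \<comment> \<open>The same lemma with the roles exchanged, as the minimum is symmetric.\<close>
  moreover have "pm_solution_on c {(t, x) \<in> ?S. ?v\<^sub>2 t x < ?v\<^sub>1 t x} ?w"
    using pm_solution_on_mp_add_left[OF assms(6) cont(1) assms(4,3)]
    by (simp add: mp_add_def min.commute)
  ultimately have "pm_solution_on c
      ({(t, x) \<in> ?S. ?v\<^sub>1 t x < ?v\<^sub>2 t x} \<union> {(t, x) \<in> ?S. ?v\<^sub>2 t x < ?v\<^sub>1 t x}) ?w"
    by (rule pm_solution_on_Un)
  also have "{(t, x) \<in> ?S. ?v\<^sub>1 t x < ?v\<^sub>2 t x} \<union> {(t, x) \<in> ?S. ?v\<^sub>2 t x < ?v\<^sub>1 t x} =
      D_set T ?v\<^sub>1 ?v\<^sub>2"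
    by (auto simp: D_set_def)
  finally have "pm_solution_on c (D_set T ?v\<^sub>1 ?v\<^sub>2) ?w" .
  \<comment> \<open>Where the two values differ, at most one is infinite, so the minimum is
    finite.\<close>
  moreover have "\<forall>(t, x)\<in>D_set T ?v\<^sub>1 ?v\<^sub>2. \<bar>?v\<^sub>1 t x \<oplus> ?v\<^sub>2 t x\<bar> \<noteq> \<infinity>"
    using assms(3,4)
    by (cases a\<^sub>1; cases a\<^sub>2) (auto simp: D_set_def mp_mult_def mp_add_def min_def)
  ultimately show ?thesis
    by (simp only: mp_pm_solution_on_def)
qed

end
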